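(* Let $\mathcal S=\{S_j\}_{j=1}^N$ be an IFS on $\mathbb R^d$ satisfying the open set condition, with a skeleton $A$, let $\Lambda=(A,V)$ be an initial graph with refined graph $G=\bigcup_{j=1}^NS_j(\Lambda)$, and let $\tau:u\mapsto P_u$ ($u\in V$) be an edge-to-trail substitution. Write $$P_u=S_{u,1}(v_{u,1})+\dots+S_{u,\ell_u}(v_{u,\ell_u}),\qquad S_{u,j}\in\mathcal S,\ v_{u,j}\in V.$$ Then the induced GIFS of $\tau$, i.e. the ordered GIFS $$E_u=S_{u,1}(E_{v_{u,1}})+\dots+S_{u,\ell_u}(E_{v_{u,\ell_u}}),\qquad u\in V,$$ is a linear GIFS.
   Context: An IFS is a finite family $\mathcal S=\{S_j\}_{j=1}^N$ of contractive similitudes of $\mathbb R^d$; its invariant set $K$ is the unique nonempty compact set with $K=\bigcup_jS_j(K)$. Open set condition: there is a nonempty open $U$ with $\bigcup_iS_i(U)\subset U$ and the $S_i(U)$ pairwise disjoint. For finite $A\subset K$, the Hata graph $H(\mathcal S,A)$ is the undirected graph with vertices $S_1,\dots,S_N$ in which $S_i,S_j$ ($i\neq j$) are adjacent iff $S_i(A)\cap S_j(A)\ne\emptyset$. If $K$ is connected, a finite $A\subset K$ is a skeleton if $A\subset\bigcup_jS_j(A)$ and $H(\mathcal S,A)$ is connected. Graphs. A walk is written $e_1+\dots+e_k$ (consecutive edges); its origin is that of $e_1$ and its terminus that of $e_k$; a trail is a walk with distinct edges. For $A=\{a_1,\dots,a_m\}$ let $G_0=\{\overrightarrow{a_ia_j}:1\le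 i,j\le m\}$ be the complete directed graph on $A$ (abstract edges, $i=j$ allowed). An initial graph is a spanning subgraph $\Lambda=(A,V)$ of $G_0$. $S_j(\Lambda)$ has vertex set $S_j(A)$ and an edge $S_j(e)=(e,S_j)$ from $S_j(x)$ to $S_j(y)$ for each $e\in V$ from $x$ to $y$; edges with different pairs $(e,j)$ are different. The refined graph is $G=\bigcup_jS_j(\Lambda)$. An edge-to-trail substitution assigns to each $u\in V$ a trail $P_u$ in $G$ with the same origin and terminus as $u$. Ordered and linear GIFS. A GIFS consists of a finite directed graph with state set $\mathcal A$ and edge set $\Gamma$, and a contractive similitude $g_\gamma$ for each $\gamma\in\Gamma$; its invariant sets are the unique nonempty compact sets with $E_i=\bigcup_{j}\bigcup_{\gamma\in\Gamma_{ij}}g_\gamma(E_j)$, where $\Gamma_{ij}$ is the set of edges from $i$ to $j$. It is ordered if for each $i$ the set of edges from $i$ carries a linear order. The equation $E_i=g_1(E_{j_1})+\dots+g_\ell(E_{j_\ell})$ means that the edges from $i$, in increasing order, go to $j_1,\dots,j_\ell$ with maps $g_1,\dots,g_\ell$. Let $\Gamma_i^k$ be the set of walks of length $k$ starting at $i$ with the lexicographic order; adjacent walks are consecutive ones. For a walk $\gamma=\gamma_1\cdots\gamma_k$ with terminal state $t$, $E_\gamma=g_{\gamma_1}\circ\dots\circ g_{\gamma_k}(E_t)$. The ordered GIFS is linear if for all $i\in\mathcal A$ and $k\ge1$, $E_\gamma\cap E_\omega\neq\emptyset$ whenever $\gamma,\omega\in\Gamma_i^k$ are adjacent. *)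

theory Defs
  imports "HOL-Analysis.Analysis" "Graph_Theory.Digraph_Component"
begin

section \<open>Iterated function systems\<close>

definition contractive_similitude :: "('a::metric_space \<Rightarrow> 'a) \<Rightarrow> bool" where
  "contractive_similitude f \<longleftrightarrow>
     (\<exists>r. 0 < r \<and> r < 1 \<and> (\<forall>x y. dist (f x) (f y) = r * dist x y))"

text \<open>
  An IFS with \<open>N\<close> maps is given by \<open>S 1, \<dots>, S N\<close>; values of \<open>S\<close> at other indices are irrelevant.
  The empty family is excluded, since it has no nonempty invariant set.
\<close>

definition ifs :: "nat \<Rightarrow> (nat \<Rightarrow> 'a::metric_space \<Rightarrow> 'a) \<Rightarrow> bool" where
  "ifs N S \<longleftrightarrow> 1 \<le> N \<and> (\<forall>j\<in>{1..N}. contractive_similitude (S j))"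

text \<open>
  In a complete space the definite description is justified by Hutchinson's theorem.
\<close>

definition ifs_invariant_set :: "nat \<Rightarrow> (nat \<Rightarrow> 'a::metric_space \<Rightarrow> 'a) \<Rightarrow> 'a set" where
  "ifs_invariant_set N S =
     (THE K. compact K \<and> K \<noteq> {} \<and> K = (\<Union>j\<in>{1..N}. S j ` K))"

definition open_set_condition :: "nat \<Rightarrow> (nat \<Rightarrow> 'a::metric_space \<Rightarrow> 'a) \<Rightarrow> bool" where
  "open_set_condition N S \<longleftrightarrow>
     (\<exists>U. open U \<and> U \<noteq> {} \<and> (\<Union>i\<in>{1..N}. S i ` U) \<subseteq> U \<and>
          disjoint_family_on (\<lambda>i. S i ` U) {1..N})"

text \<open>
  The undirected Hata graph is encoded as a digraph having both orientations of each edge.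
  Its vertices are the indices of the maps.
\<close>

definition hata_graph ::
    "nat \<Rightarrow> (nat \<Rightarrow> 'a \<Rightarrow> 'a) \<Rightarrow> 'a set \<Rightarrow> (nat, nat \<times> nat) pre_digraph" where
  "hata_graph N S A =
     \<lparr> verts = {1..N},
       arcs = {(i, j). i \<in> {1..N} \<and> j \<in> {1..N} \<and> i \<noteq> j \<and> S i ` A \<inter> S j ` A \<noteq> {}},
       tail = fst, head = snd \<rparr>"

definition skeleton :: "nat \<Rightarrow> (nat \<Rightarrow> 'a::metric_space \<Rightarrow> 'a) \<Rightarrow> 'a set \<Rightarrow> bool" where
  "skeleton N S A \<longleftrightarrow>
     topological_space_class.connected (ifs_invariant_set N S) \<and>
     finite A \<and> A \<subseteq> ifs_invariant_set N S \<and>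
     A \<subseteq> (\<Union>j\<in>{1..N}. S j ` A) \<and>
     Digraph_Component.connected (hata_graph N S A)"

section \<open>Initial graphs, refined graphs and edge-to-trail substitutions\<close>

text \<open>There is exactly one abstract edge for each ordered pair of points, loops included.\<close>

definition complete_graph_on :: "'a set \<Rightarrow> ('a, 'a \<times> 'a) pre_digraph" where
  "complete_graph_on A = \<lparr> verts = A, arcs = A \<times> A, tail = fst, head = snd \<rparr>"

definition initial_graph :: "'a set \<Rightarrow> ('a, 'a \<times> 'a) pre_digraph \<Rightarrow> bool" where
  "initial_graph A \<Lambda> \<longleftrightarrow> spanning \<Lambda> (complete_graph_on A)"

text \<open>
  The edge \<open>S\<^sub>j(e)\<close> is the pair \<open>(e, j)\<close>, so that different pairs give different (possibly parallel)
  edges, whereas vertices are points of the space.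
\<close>

definition refined_graph ::
    "nat \<Rightarrow> (nat \<Rightarrow> 'a \<Rightarrow> 'a) \<Rightarrow> ('a, 'e) pre_digraph \<Rightarrow> ('a, 'e \<times> nat) pre_digraph" where
  "refined_graph N S \<Lambda> =
     \<lparr> verts = (\<Union>j\<in>{1..N}. S j ` verts \<Lambda>),
       arcs = arcs \<Lambda> \<times> {1..N},
       tail = (\<lambda>(e, j). S j (tail \<Lambda> e)),
       head = (\<lambda>(e, j). S j (head \<Lambda> e)) \<rparr>"

text \<open>
  Trails in the sense of \<open>pre_digraph.trail\<close> may be empty; here a trail consists of at least one edge.
\<close>

definition edge_to_trail_substitution ::
    "nat \<Rightarrow> (nat \<Rightarrow> 'a \<Rightarrow> 'a) \<Rightarrow> ('a, 'e) pre_digraph \<Rightarrow> ('e \<Rightarrow> ('e \<times> nat) list) \<Rightarrow> bool" where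
  "edge_to_trail_substitution N S \<Lambda> P \<longleftrightarrow>
     (\<forall>u\<in>arcs \<Lambda>. P u \<noteq> [] \<and>
        pre_digraph.trail (refined_graph N S \<Lambda>) (tail \<Lambda> u) (P u) (head \<Lambda> u))"

section \<open>Ordered and linear graph-directed IFS\<close>

text \<open>
  \<open>edge_ord X i\<close> is the (reflexive) order on the edges starting at the state \<open>i\<close>.
\<close>

record ('s, 'e, 'a) ordered_gifs_data =
  state_graph :: "('s, 'e) pre_digraph"
  edge_map :: "'e \<Rightarrow> 'a \<Rightarrow> 'a"
  edge_ord :: "'s \<Rightarrow> 'e rel"

text \<open>
  Every state needs an outgoing edge, as its invariant set would be empty otherwise.
\<close>

definition ordered_gifs :: "('s, 'e, 'a::metric_space) ordered_gifs_data \<Rightarrow> bool" where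
  "ordered_gifs X \<longleftrightarrow>
     fin_digraph (state_graph X) \<and>
     (\<forall>i\<in>verts (state_graph X). out_arcs (state_graph X) i \<noteq> {}) \<and>
     (\<forall>e\<in>arcs (state_graph X). contractive_similitude (edge_map X e)) \<and>
     (\<forall>i\<in>verts (state_graph X). linear_order_on (out_arcs (state_graph X) i) (edge_ord X i))"

text \<open>
  Families of sets are extensional (fixed to \<open>undefined\<close> outside the states), so that the
  family of invariant sets is unique as a function.
\<close>

definition gifs_invariant_family ::
    "('s, 'e, 'a::metric_space) ordered_gifs_data \<Rightarrow> ('s \<Rightarrow> 'a set) \<Rightarrow> bool" where
  "gifs_invariant_family X E \<longleftrightarrow>
     E \<in> verts (state_graph X) \<rightarrow>\<^sub>E {C. compact C \<and> C \<noteq> {}} \<and>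
     (\<forall>i\<in>verts (state_graph X).
        E i = (\<Union>e\<in>out_arcs (state_graph X) i. edge_map X e ` E (head (state_graph X) e)))"

definition gifs_invariant_sets ::
    "('s, 'e, 'a::metric_space) ordered_gifs_data \<Rightarrow> 's \<Rightarrow> 'a set" where
  "gifs_invariant_sets X = (THE E. gifs_invariant_family X E)"

definition gifs_walks :: "('s, 'e, 'a) ordered_gifs_data \<Rightarrow> 's \<Rightarrow> nat \<Rightarrow> 'e list set" where
  "gifs_walks X i k = {\<gamma>. length \<gamma> = k \<and> (\<exists>t. pre_digraph.awalk (state_graph X) i \<gamma> t)}"

text \<open>
  Two walks with the same initial state first differ in edges with a common tail, hence it
  suffices to compare edges with the same tail.
\<close>

definition gifs_walk_less :: "('s, 'e, 'a) ordered_gifs_data \<Rightarrow> 'e list rel" where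
  "gifs_walk_less X =
     lexord {(e, f). tail (state_graph X) e = tail (state_graph X) f \<and> e \<noteq> f \<and>
                     (e, f) \<in> edge_ord X (tail (state_graph X) e)}"

definition adjacent_walks ::
    "('s, 'e, 'a) ordered_gifs_data \<Rightarrow> 's \<Rightarrow> nat \<Rightarrow> 'e list \<Rightarrow> 'e list \<Rightarrow> bool" where
  "adjacent_walks X i k \<gamma> \<omega> \<longleftrightarrow>
     \<gamma> \<in> gifs_walks X i k \<and> \<omega> \<in> gifs_walks X i k \<and> (\<gamma>, \<omega>) \<in> gifs_walk_less X \<and>
     \<not> (\<exists>\<xi>\<in>gifs_walks X i k. (\<gamma>, \<xi>) \<in> gifs_walk_less X \<and> (\<xi>, \<omega>) \<in> gifs_walk_less X)"

text \<open>The set \<open>E\<^sub>\<gamma>\<close> for a walk \<open>\<gamma>\<close> starting at \<open>i\<close>.\<close>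

definition gifs_cylinder ::
    "('s, 'e, 'a::metric_space) ordered_gifs_data \<Rightarrow> 's \<Rightarrow> 'e list \<Rightarrow> 'a set" where
  "gifs_cylinder X i \<gamma> =
     foldr (\<lambda>e C. edge_map X e ` C) \<gamma>
       (gifs_invariant_sets X (pre_digraph.awlast (state_graph X) i \<gamma>))"

definition linear_gifs :: "('s, 'e, 'a::metric_space) ordered_gifs_data \<Rightarrow> bool" where
  "linear_gifs X \<longleftrightarrow>
     ordered_gifs X \<and>
     (\<forall>i\<in>verts (state_graph X). \<forall>k\<ge>1. \<forall>\<gamma> \<omega>.
        adjacent_walks X i k \<gamma> \<omega> \<longrightarrow> gifs_cylinder X i \<gamma> \<inter> gifs_cylinder X i \<omega> \<noteq> {})"

section \<open>The induced GIFS\<close>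

text \<open>
  If \<open>P u = [(v\<^sub>0, j\<^sub>0), \<dots>]\<close>, i.e. \<open>P\<^sub>u = S\<^bsub>j\<^sub>0\<^esub>(v\<^sub>0) + \<dots>\<close>, then the \<open>n\<close>-th edge from the state \<open>u\<close>
  is \<open>(u, n)\<close>; it leads to \<open>v\<^sub>n\<close> and carries the map \<open>S\<^bsub>j\<^sub>n\<^esub>\<close>.
\<close>

definition induced_gifs ::
    "(nat \<Rightarrow> 'a \<Rightarrow> 'a) \<Rightarrow> ('a, 'e) pre_digraph \<Rightarrow> ('e \<Rightarrow> ('e \<times> nat) list)
      \<Rightarrow> ('e, 'e \<times> nat, 'a) ordered_gifs_data" where
  "induced_gifs S \<Lambda> P =
     \<lparr> state_graph =
         \<lparr> verts = arcs \<Lambda>,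
           arcs = {(u, n). u \<in> arcs \<Lambda> \<and> n < length (P u)},
           tail = fst,
           head = (\<lambda>(u, n). fst (P u ! n)) \<rparr>,
       edge_map = (\<lambda>(u, n). S (snd (P u ! n))),
       edge_ord = (\<lambda>u. {((u, m), (u, n)) | m n. m \<le> n \<and> n < length (P u)}) \<rparr>"

end

theory Submission
  imports Defs
begin

text \<open>
  The theorem rests on the fact that the origin and the terminus of an edge \<open>u\<close> both belong to
  \<open>E\<^sub>u\<close>. The trail \<open>P\<^sub>u\<close> starts at the origin of \<open>u\<close>, so this origin is the image under \<open>S\<^sub>u\<^sub>,\<^sub>1\<close> of
  the origin of \<open>v\<^sub>u\<^sub>,\<^sub>1\<close>; similarly for the terminus and the last edge of \<open>P\<^sub>u\<close>. The finite sets
  \<open>{origin, terminus}\<close> therefore satisfy the set equation of the GIFS with an inclusion in place of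
  the equality, and because the maps contract, every compact family with this property lies inside
  the invariant family (\<open>compact_subinvariant_subset\<close>). The same principle gives uniqueness of
  the invariant family. For its existence the closure of the forward orbit of the end points
  is used (\<open>invariant_family_exists\<close>).

  Iterating the substitution, the cylinders of the walks of length \<open>k\<close> from \<open>u\<close>, in lexicographic
  order, follow a walk in space: the terminus of each piece is the origin of the next one. Indeed,
  two adjacent walks have a common prefix, then two consecutive edges of one \<open>P\<^sub>w\<close>, after
  which the smaller walk only takes last edges and the larger one only first edges. A walk of
  last edges has the terminus of its initial state in its cylinder and a walk of first edges has
  the origin (\<open>unbeaten_walk_contains_endpoint\<close>). As consecutive edges of the trail
  \<open>P\<^sub>w\<close> share a vertex, the image of that vertex under the common prefix lies in both cylinders.

  This argument is given for an ordered GIFS whose states carry an origin and a terminus that are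
  linked in this way (\<open>chained_endpoints\<close>); the induced GIFS is of this kind because every
  \<open>P\<^sub>u\<close> is a walk from the origin to the terminus of \<open>u\<close>.
\<close>

section \<open>Contractive similitudes\<close>

lemma contractive_similitude_continuous:
  assumes "contractive_similitude f"
  shows "continuous_on T f"
proof -
  obtain r where r: "0 < r" "\<forall>x y. dist (f x) (f y) = r * dist x y"
    using assms by (auto simp: contractive_similitude_def)
  have "r-lipschitz_on T f"
    using r by (intro lipschitz_onI) auto
  then show ?thesis
    by (rule lipschitz_on_continuous_on)
qed

text \<open>Once the radius dominates the displacement of the centre, the contraction wins.\<close>

lemma contractive_similitude_cball:
  assumes "contractive_similitude f"
  shows "eventually (\<lambda>R. f ` cball z R \<subseteq> cball z R) at_top"
proof -
  obtain r where r: "0 < r" "r < 1" "\<forall>x y. dist (f x) (f y) = r * dist x y"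
    using assms by (auto simp: contractive_similitude_def)
  have "f ` cball z R \<subseteq> cball z R" if R: "dist z (f z) / (1 - r) \<le> R" for R
  proof
    fix y assume "y \<in> f ` cball z R"
    then obtain x where x: "y = f x" "dist z x \<le> R" by auto
    have "dist z y \<le> dist z (f z) + dist (f z) (f x)"
      unfolding x by (rule dist_triangle)
    also have "\<dots> \<le> (1 - r) * R + r * R"
      using R r x(2) by (intro add_mono) (auto simp: field_simps)
    finally show "y \<in> cball z R" by (simp add: algebra_simps)
  qed
  then show ?thesis
    using eventually_ge_at_top[of "dist z (f z) / (1 - r)"] by (rule eventually_mono[rotated])
qed

lemma closure_image_of_bounded:
  fixes f :: "'a::heine_borel \<Rightarrow> 'b::t2_space"
  assumes "bounded L" "continuous_on (closure L) f"
  shows "closure (f ` L) = f ` closure L"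
proof
  have "compact (f ` closure L)"
    using assms by (intro compact_continuous_image) (auto simp: compact_closure)
  then show "closure (f ` L) \<subseteq> f ` closure L"
    by (intro closure_minimal image_mono closure_subset compact_imp_closed)
  show "f ` closure L \<subseteq> closure (f ` L)"
    by (intro image_closure_subset assms closed_closure closure_subset)
qed

lemma closure_finite_UN:
  assumes "finite I"
  shows "closure (\<Union>i\<in>I. f i) = (\<Union>i\<in>I. closure (f i))"
  using assms by (induction I) auto

section \<open>Invariant families of a graph-directed IFS\<close>

text \<open>
  Points of \<open>C\<close> at maximal distance from the invariant sets are images of points of \<open>C\<close>, whose
  distance would have to be larger still if it were positive.
\<close>

lemma compact_subinvariant_subset:
  fixes X :: "('s, 'e, 'a::heine_borel) ordered_gifs_data"
  defines "G \<equiv> state_graph X"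
  assumes X: "ordered_gifs X"
    and E: "gifs_invariant_family X E"
    and compact: "\<And>i. i \<in> verts G \<Longrightarrow> compact (C i)"
    and sub: "\<And>i. i \<in> verts G \<Longrightarrow> C i \<subseteq> (\<Union>e\<in>out_arcs G i. edge_map X e ` C (head G e))"
    and i: "i \<in> verts G"
  shows "C i \<subseteq> E i"
proof -
  interpret fin_digraph G
    using X by (simp add: ordered_gifs_def G_def)
  have Ecl: "closed (E i)" "E i \<noteq> {}" if "i \<in> verts G" for i
    using E that by (auto simp: gifs_invariant_family_def G_def PiE_def Pi_def compact_imp_closed)
  have att: "\<exists>x\<in>C j. \<forall>y\<in>C j. infdist y (E j) \<le> infdist x (E j)"
    if "j \<in> verts G" "C j \<noteq> {}" for j
    using that by (intro continuous_attains_sup compact continuous_intros) auto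
  \<comment> \<open>Some \<open>C j\<close> may be empty; the maximal distance is taken over the others.\<close>
  define W where "W = {j \<in> verts G. C j \<noteq> {}}"
  have "finite W" by (simp add: W_def)
  have "\<exists>p. \<forall>j\<in>W. p j \<in> C j \<and> (\<forall>y\<in>C j. infdist y (E j) \<le> infdist (p j) (E j))"
    using att unfolding W_def by (intro bchoice) auto
  then obtain p where p: "\<And>j. j \<in> W \<Longrightarrow> p j \<in> C j"
    "\<And>j y. j \<in> W \<Longrightarrow> y \<in> C j \<Longrightarrow> infdist y (E j) \<le> infdist (p j) (E j)"
    by blast
  have zero: "infdist x (E j) = 0" if j: "j \<in> verts G" and x: "x \<in> C j" for j x
  proof -
    have W: "W \<noteq> {}" "j \<in> W" using j x by (auto simp: W_def)
    define D where "D = Max ((\<lambda>j. infdist (p j) (E j)) ` W)"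
    have D: "infdist y (E l) \<le> D" if "l \<in> verts G" "y \<in> C l" for l y
    proof -
      have "l \<in> W" using that by (auto simp: W_def)
      then have "infdist y (E l) \<le> infdist (p l) (E l)" using p(2) that by blast
      also have "\<dots> \<le> D" unfolding D_def using \<open>finite W\<close> \<open>l \<in> W\<close> by (intro Max_ge) auto
      finally show ?thesis .
    qed
    have "D \<in> (\<lambda>j. infdist (p j) (E j)) ` W"
      unfolding D_def using \<open>finite W\<close> W by (intro Max_in) auto
    then obtain m where m: "m \<in> W" "D = infdist (p m) (E m)" by blast
    have mv: "m \<in> verts G" using m by (simp add: W_def)
    obtain e y where e: "e \<in> out_arcs G m" and y: "y \<in> C (head G e)" "p m = edge_map X e y"
      using sub[OF mv] p(1)[OF m(1)] by auto
    have hv: "head G e \<in> verts G" using e by simp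
    obtain r where r: "0 < r" "r < 1" "\<forall>x y. dist (edge_map X e x) (edge_map X e y) = r * dist x y"
      using X e by (auto simp: ordered_gifs_def G_def contractive_similitude_def)
    obtain z where z: "z \<in> E (head G e)" "infdist y (E (head G e)) = dist y z"
      using infdist_attains_inf[OF Ecl[OF hv]] by metis
    have "edge_map X e z \<in> E m"
      using E mv e z by (auto simp: gifs_invariant_family_def G_def)
    then have "D \<le> dist (edge_map X e y) (edge_map X e z)"
      unfolding m y by (rule infdist_le)
    also have "\<dots> = r * infdist y (E (head G e))" using r z by simp
    also have "\<dots> \<le> r * D" using D[OF hv y(1)] r by simp
    finally have "(1 - r) * D \<le> 0" by (simp add: algebra_simps)
    then have "D \<le> 0" using r by (simp add: mult_le_0_iff)
    then show ?thesis using D[OF j x] infdist_nonneg[of x "E j"] by linarith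
  qed
  show ?thesis
    using zero[OF i] in_closed_iff_infdist_zero[OF Ecl[OF i]] by blast
qed

lemma invariant_family_unique:
  fixes X :: "('s, 'e, 'a::heine_borel) ordered_gifs_data"
  assumes X: "ordered_gifs X"
    and E: "gifs_invariant_family X E" and F: "gifs_invariant_family X F"
  shows "E = F"
proof -
  have *: "E i \<subseteq> F i" if "i \<in> verts (state_graph X)"
    and E: "gifs_invariant_family X E" and F: "gifs_invariant_family X F" for E F i
    using E by (intro compact_subinvariant_subset[OF X F] that)
      (auto simp: gifs_invariant_family_def PiE_def Pi_def)
  show ?thesis
  proof (rule PiE_ext)
    show "E \<in> verts (state_graph X) \<rightarrow>\<^sub>E {C. compact C \<and> C \<noteq> {}}"
      and "F \<in> verts (state_graph X) \<rightarrow>\<^sub>E {C. compact C \<and> C \<noteq> {}}"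
      using E F by (simp_all add: gifs_invariant_family_def)
  qed (use * E F in blast)
qed

inductive forward_orbit ::
  "('s, 'e, 'a) ordered_gifs_data \<Rightarrow> ('s \<Rightarrow> 'a set) \<Rightarrow> 's \<Rightarrow> 'a \<Rightarrow> bool"
  for X C where
  seed: "i \<in> verts (state_graph X) \<Longrightarrow> x \<in> C i \<Longrightarrow> forward_orbit X C i x"
| step: "e \<in> arcs (state_graph X) \<Longrightarrow> forward_orbit X C (head (state_graph X) e) x
    \<Longrightarrow> forward_orbit X C (tail (state_graph X) e) (edge_map X e x)"

text \<open>
  The forward orbit of \<open>C\<close> satisfies the set equation exactly, because the seeds themselves are
  images of seeds; it is bounded since a large ball is mapped into itself by all edge maps. Taking
  closures keeps the equation, as only finitely many continuous images of bounded sets occur.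
\<close>

lemma invariant_family_exists:
  fixes X :: "('s, 'e, 'a::heine_borel) ordered_gifs_data"
  defines "G \<equiv> state_graph X"
  assumes X: "ordered_gifs X"
    and seed_bounded: "\<And>i. i \<in> verts G \<Longrightarrow> bounded (C i)"
    and nonempty: "\<And>i. i \<in> verts G \<Longrightarrow> C i \<noteq> {}"
    and sub: "\<And>i. i \<in> verts G \<Longrightarrow> C i \<subseteq> (\<Union>e\<in>out_arcs G i. edge_map X e ` C (head G e))"
  shows "\<exists>E. gifs_invariant_family X E"
proof -
  interpret fin_digraph G
    using X by (simp add: ordered_gifs_def G_def)
  have sim: "contractive_similitude (edge_map X e)" if "e \<in> arcs G" for e
    using X that by (simp add: ordered_gifs_def G_def)
  define L where "L i = {x. forward_orbit X C i x}" for i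
  have CL: "C i \<subseteq> L i" if "i \<in> verts G" for i
    using that by (auto simp: L_def G_def intro: seed)
  have L_eq: "L i = (\<Union>e\<in>out_arcs G i. edge_map X e ` L (head G e))" if i: "i \<in> verts G" for i
  proof
    show "L i \<subseteq> (\<Union>e\<in>out_arcs G i. edge_map X e ` L (head G e))"
    proof
      fix x assume "x \<in> L i"
      then have "forward_orbit X C i x" by (simp add: L_def)
      then show "x \<in> (\<Union>e\<in>out_arcs G i. edge_map X e ` L (head G e))"
      proof cases
        case seed
        then obtain e y where "e \<in> out_arcs G i" "y \<in> C (head G e)" "x = edge_map X e y"
          using sub[OF i] by blast
        moreover from this have "y \<in> L (head G e)" using CL[of "head G e"] by auto
        ultimately show ?thesis by blast
      next
        case (step e y)
        then show ?thesis by (auto simp: L_def G_def in_out_arcs_conv)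
      qed
    qed
    show "(\<Union>e\<in>out_arcs G i. edge_map X e ` L (head G e)) \<subseteq> L i"
      by (auto simp: L_def G_def intro: step)
  qed
  obtain z :: 'a where True by simp
  have "eventually (\<lambda>R. C i \<subseteq> cball z R) at_top" if i: "i \<in> verts G" for i
  proof -
    obtain R0 where R0: "C i \<subseteq> cball z R0"
      using seed_bounded[OF i, unfolded bounded_any_center[where a = z]] by (auto simp: bounded_def subset_eq)
    have "C i \<subseteq> cball z R" if "R0 \<le> R" for R
      using R0 that by auto
    then show ?thesis
      using eventually_ge_at_top[of R0] by (rule eventually_mono[rotated])
  qed
  then have "eventually (\<lambda>R. (\<forall>i\<in>verts G. C i \<subseteq> cball z R) \<and>
      (\<forall>e\<in>arcs G. edge_map X e ` cball z R \<subseteq> cball z R)) at_top"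
    using sim by (auto intro!: eventually_conj eventually_ball_finite contractive_similitude_cball)
  from eventually_happens'[OF trivial_limit_at_top_linorder this]
  obtain R where R: "\<And>i. i \<in> verts G \<Longrightarrow> C i \<subseteq> cball z R"
      "\<And>e. e \<in> arcs G \<Longrightarrow> edge_map X e ` cball z R \<subseteq> cball z R"
    by blast
  have "x \<in> cball z R" if "forward_orbit X C i x" for i x
    using that
  proof induction
    case (seed i x)
    then show ?case using R(1) unfolding G_def by blast
  next
    case (step e x)
    then show ?case using R(2) unfolding G_def by blast
  qed
  then have L_bounded: "bounded (L i)" for i
    by (intro bounded_subset[OF bounded_cball[of z R]]) (auto simp: L_def)
  define E where "E = restrict (\<lambda>i. closure (L i)) (verts G)"
  have "E i = (\<Union>e\<in>out_arcs G i. edge_map X e ` E (head G e))" if i: "i \<in> verts G" for i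
  proof -
    have "E i = closure (\<Union>e\<in>out_arcs G i. edge_map X e ` L (head G e))"
      using L_eq[OF i] i by (simp add: E_def)
    also have "\<dots> = (\<Union>e\<in>out_arcs G i. closure (edge_map X e ` L (head G e)))"
      by (intro closure_finite_UN) (simp add: out_arcs_def)
    also have "\<dots> = (\<Union>e\<in>out_arcs G i. edge_map X e ` E (head G e))"
      using L_bounded sim
      by (intro SUP_cong refl)
        (simp add: E_def closure_image_of_bounded contractive_similitude_continuous)
    finally show ?thesis .
  qed
  moreover have "E \<in> verts G \<rightarrow>\<^sub>E {C. compact C \<and> C \<noteq> {}}"
    using L_bounded CL nonempty by (fastforce simp: E_def compact_closure)
  ultimately show ?thesis
    unfolding gifs_invariant_family_def G_def by blast
qed

lemma gifs_invariant_sets_invariant: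
  fixes X :: "('s, 'e, 'a::heine_borel) ordered_gifs_data"
  assumes "ordered_gifs X" "gifs_invariant_family X E"
  shows "gifs_invariant_family X (gifs_invariant_sets X)"
  unfolding gifs_invariant_sets_def
  by (rule theI[where P = "gifs_invariant_family X", OF assms(2)])
    (rule invariant_family_unique[OF assms(1) _ assms(2)])

section \<open>Walks and cylinders\<close>

lemma gifs_walks_0: "i \<in> verts (state_graph X) \<Longrightarrow> gifs_walks X i 0 = {[]}"
  by (auto simp: gifs_walks_def pre_digraph.awalk_def pre_digraph.cas.simps)

lemma Cons_in_gifs_walks_iff:
  assumes "ordered_gifs X"
  shows "e # s \<in> gifs_walks X i k \<longleftrightarrow> (\<exists>l. k = Suc l \<and> e \<in> out_arcs (state_graph X) i \<and>
           s \<in> gifs_walks X (head (state_graph X) e) l)"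
proof -
  interpret fin_digraph "state_graph X"
    using assms by (simp add: ordered_gifs_def)
  show ?thesis
    by (auto simp: gifs_walks_def awalk_Cons_iff)
qed

lemma gifs_walks_nonempty:
  assumes X: "ordered_gifs X" and "i \<in> verts (state_graph X)"
  shows "gifs_walks X i k \<noteq> {}"
  using assms(2)
proof (induction k arbitrary: i)
  case 0
  then show ?case by (simp add: gifs_walks_0)
next
  case (Suc k)
  interpret fin_digraph "state_graph X"
    using X by (simp add: ordered_gifs_def)
  obtain e where e: "e \<in> out_arcs (state_graph X) i"
    using X Suc.prems unfolding ordered_gifs_def by blast
  obtain s where "s \<in> gifs_walks X (head (state_graph X) e) k"
    using Suc.IH[of "head (state_graph X) e"] e by auto
  then have "e # s \<in> gifs_walks X i (Suc k)"
    using e by (auto simp: Cons_in_gifs_walks_iff[OF X])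
  then show ?case by blast
qed

lemma gifs_cylinder_Nil: "gifs_cylinder X i [] = gifs_invariant_sets X i"
  by (simp add: gifs_cylinder_def pre_digraph.awalk_verts.simps)

lemma gifs_cylinder_Cons:
  fixes X :: "('s, 'e, 'a::metric_space) ordered_gifs_data"
  shows "gifs_cylinder X i (e # s) = edge_map X e ` gifs_cylinder X (head (state_graph X) e) s"
proof -
  have "pre_digraph.awalk_verts G j s \<noteq> []" for G :: "('s, 'e) pre_digraph" and j
    by (cases s) (simp_all add: pre_digraph.awalk_verts.simps)
  then show ?thesis
    by (simp add: gifs_cylinder_def pre_digraph.awalk_verts.simps)
qed

section \<open>The order of edges and of walks\<close>

definition edge_less :: "('s, 'e, 'a) ordered_gifs_data \<Rightarrow> 'e rel" where
  "edge_less X = {(e, f). tail (state_graph X) e = tail (state_graph X) f \<and> e \<noteq> f \<and>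
                     (e, f) \<in> edge_ord X (tail (state_graph X) e)}"

lemma gifs_walk_less_eq_lexord: "gifs_walk_less X = lexord (edge_less X)"
  by (simp add: gifs_walk_less_def edge_less_def)

lemma edge_less_irrefl: "(e, e) \<notin> edge_less X"
  by (simp add: edge_less_def)

lemma edge_less_tail: "(e, f) \<in> edge_less X \<Longrightarrow> tail (state_graph X) e = tail (state_graph X) f"
  by (simp add: edge_less_def)

lemma lexord_converse_eq_length:
  assumes "length xs = length ys"
  shows "(xs, ys) \<in> lexord (r\<inverse>) \<longleftrightarrow> (ys, xs) \<in> lexord r"
  using assms by (induction xs ys rule: list_induct2) auto

lemma edge_less_trans_asym:
  assumes X: "ordered_gifs X" and i: "i \<in> verts (state_graph X)"
  shows "transp_on (out_arcs (state_graph X) i) (\<lambda>e f. (e, f) \<in> edge_less X)"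
    and "asymp_on (out_arcs (state_graph X) i) (\<lambda>e f. (e, f) \<in> edge_less X)"
proof -
  have "linear_order_on (out_arcs (state_graph X) i) (edge_ord X i)"
    using X i by (simp add: ordered_gifs_def)
  then have "trans (edge_ord X i)" "antisym (edge_ord X i)"
    by (simp_all add: order_on_defs)
  then have tr: "\<And>e f h. (e, f) \<in> edge_ord X i \<Longrightarrow> (f, h) \<in> edge_ord X i \<Longrightarrow> (e, h) \<in> edge_ord X i"
    and asym: "\<And>e f. (e, f) \<in> edge_ord X i \<Longrightarrow> (f, e) \<in> edge_ord X i \<Longrightarrow> e = f"
    by (meson transD, meson antisymD)
  have less: "(e, f) \<in> edge_less X \<longleftrightarrow> e \<noteq> f \<and> (e, f) \<in> edge_ord X i"
    if "e \<in> out_arcs (state_graph X) i" "f \<in> out_arcs (state_graph X) i" for e f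
    using that by (auto simp: edge_less_def)
  show "transp_on (out_arcs (state_graph X) i) (\<lambda>e f. (e, f) \<in> edge_less X)"
  proof (rule transp_onI)
    fix e f h
    assume "e \<in> out_arcs (state_graph X) i" "f \<in> out_arcs (state_graph X) i"
      "h \<in> out_arcs (state_graph X) i" "(e, f) \<in> edge_less X" "(f, h) \<in> edge_less X"
    then show "(e, h) \<in> edge_less X"
      using tr asym by (metis less)
  qed
  show "asymp_on (out_arcs (state_graph X) i) (\<lambda>e f. (e, f) \<in> edge_less X)"
  proof (rule asymp_onI)
    fix e f
    assume "e \<in> out_arcs (state_graph X) i" "f \<in> out_arcs (state_graph X) i"
      "(e, f) \<in> edge_less X"
    then show "(f, e) \<notin> edge_less X"
      using asym by (metis less)
  qed
qed

lemma first_and_last_edge_exist: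
  assumes X: "ordered_gifs X" and i: "i \<in> verts (state_graph X)"
  obtains e f where
    "e \<in> out_arcs (state_graph X) i" "\<forall>h\<in>arcs (state_graph X). (h, e) \<notin> edge_less X"
    "f \<in> out_arcs (state_graph X) i" "\<forall>h\<in>arcs (state_graph X). (f, h) \<notin> edge_less X"
proof -
  interpret fin_digraph "state_graph X"
    using X by (simp add: ordered_gifs_def)
  have out: "finite (out_arcs (state_graph X) i)" "out_arcs (state_graph X) i \<noteq> {}"
    using X i unfolding ordered_gifs_def by (simp_all add: out_arcs_def)
  note order = edge_less_trans_asym(2,1)[OF X i]
  from Finite_Set.bex_min_element[OF out(1) order out(2)] obtain e where e: "e \<in> out_arcs (state_graph X) i"
      "\<forall>h\<in>out_arcs (state_graph X) i. h \<noteq> e \<longrightarrow> (h, e) \<notin> edge_less X" by blast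
  from Finite_Set.bex_max_element[OF out(1) order out(2)] obtain f where f: "f \<in> out_arcs (state_graph X) i"
      "\<forall>h\<in>out_arcs (state_graph X) i. h \<noteq> f \<longrightarrow> (f, h) \<notin> edge_less X" by blast
  have "(h, e) \<notin> edge_less X" if "h \<in> arcs (state_graph X)" for h
    using e that edge_less_irrefl[of e X] edge_less_tail[of h e X] by auto
  moreover have "(f, h) \<notin> edge_less X" if "h \<in> arcs (state_graph X)" for h
    using f that edge_less_irrefl[of f X] edge_less_tail[of f h X] by auto
  ultimately show thesis
    using that e(1) f(1) by blast
qed

section \<open>A criterion for linearity\<close>

text \<open>
  Each state \<open>i\<close> is thought of as a step from \<open>a i\<close> to \<open>b i\<close>, and the ordered edges from \<open>i\<close> replace it
  by a chain of steps with the same end points.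
\<close>

definition chained_endpoints ::
    "('s, 'e, 'a) ordered_gifs_data \<Rightarrow> ('s \<Rightarrow> 'a) \<Rightarrow> ('s \<Rightarrow> 'a) \<Rightarrow> bool" where
  "chained_endpoints X a b \<longleftrightarrow> (let G = state_graph X in
     (\<forall>e\<in>arcs G. (\<forall>h\<in>arcs G. (h, e) \<notin> edge_less X) \<longrightarrow> edge_map X e (a (head G e)) = a (tail G e)) \<and>
     (\<forall>e\<in>arcs G. (\<forall>h\<in>arcs G. (e, h) \<notin> edge_less X) \<longrightarrow> edge_map X e (b (head G e)) = b (tail G e)) \<and>
     (\<forall>e\<in>arcs G. \<forall>f\<in>arcs G. (e, f) \<in> edge_less X \<and>
        \<not> (\<exists>h\<in>arcs G. (e, h) \<in> edge_less X \<and> (h, f) \<in> edge_less X) \<longrightarrow>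
        edge_map X e (b (head G e)) = edge_map X f (a (head G f))))"

text \<open>
  The pairs \<open>{a i, b i}\<close> lie in the images of such pairs under the first and the last edge
  from \<open>i\<close>. They serve as seeds for the existence of the invariant sets, and they are absorbed by them.
\<close>

lemma endpoints_in_invariant_sets:
  fixes X :: "('s, 'e, 'a::heine_borel) ordered_gifs_data"
  assumes X: "ordered_gifs X" and ch: "chained_endpoints X a b"
    and i: "i \<in> verts (state_graph X)"
  shows "a i \<in> gifs_invariant_sets X i" "b i \<in> gifs_invariant_sets X i"
proof -
  let ?G = "state_graph X"
  have sub: "{a i, b i} \<subseteq> (\<Union>e\<in>out_arcs ?G i. edge_map X e ` {a (head ?G e), b (head ?G e)})"
    if i: "i \<in> verts ?G" for i
  proof -
    obtain e f where
      "e \<in> out_arcs ?G i" "\<forall>h\<in>arcs ?G. (h, e) \<notin> edge_less X"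
      "f \<in> out_arcs ?G i" "\<forall>h\<in>arcs ?G. (f, h) \<notin> edge_less X"
      using first_and_last_edge_exist[OF X i] by metis
    then have "e \<in> out_arcs ?G i" "edge_map X e (a (head ?G e)) = a i"
      "f \<in> out_arcs ?G i" "edge_map X f (b (head ?G f)) = b i"
      using ch by (auto simp: chained_endpoints_def Let_def)
    then have "a i \<in> edge_map X e ` {a (head ?G e), b (head ?G e)}"
      "b i \<in> edge_map X f ` {a (head ?G f), b (head ?G f)}"
      by (auto intro!: rev_image_eqI[of "a (head ?G e)"] rev_image_eqI[of "b (head ?G f)"])
    with \<open>e \<in> out_arcs ?G i\<close> \<open>f \<in> out_arcs ?G i\<close> show ?thesis by blast
  qed
  have "\<exists>E. gifs_invariant_family X E"
    by (rule invariant_family_exists[where C = "\<lambda>i. {a i, b i}", OF X _ _ sub]) simp_all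
  then have inv: "gifs_invariant_family X (gifs_invariant_sets X)"
    using gifs_invariant_sets_invariant[OF X] by blast
  have "{a i, b i} \<subseteq> gifs_invariant_sets X i"
    by (rule compact_subinvariant_subset[where C = "\<lambda>i. {a i, b i}", OF X inv _ sub i]) simp_all
  then show "a i \<in> gifs_invariant_sets X i" "b i \<in> gifs_invariant_sets X i" by auto
qed

text \<open>
  An edge of an unbeaten walk is itself unbeaten, as any better edge could be prolonged to a walk of
  the same length; so the distinguished point is passed on along the whole walk. With \<open>Q\<close> the edge
  order or its converse, this treats the largest and the smallest walk at once.
\<close>

lemma unbeaten_walk_contains_endpoint:
  assumes X: "ordered_gifs X"
    and Q: "\<And>e f. (e, f) \<in> Q \<Longrightarrow> tail (state_graph X) e = tail (state_graph X) f"
    and p: "\<And>i. i \<in> verts (state_graph X) \<Longrightarrow> p i \<in> gifs_invariant_sets X i"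
    and edge: "\<And>e. e \<in> arcs (state_graph X) \<Longrightarrow> (\<forall>h\<in>arcs (state_graph X). (e, h) \<notin> Q) \<Longrightarrow>
       edge_map X e (p (head (state_graph X) e)) = p (tail (state_graph X) e)"
    and "i \<in> verts (state_graph X)"
    and "\<gamma> \<in> gifs_walks X i k"
    and "\<And>\<xi>. \<xi> \<in> gifs_walks X i k \<Longrightarrow> (\<gamma>, \<xi>) \<notin> lexord Q"
  shows "p i \<in> gifs_cylinder X i \<gamma>"
  using assms(5-7)
proof (induction \<gamma> arbitrary: i k)
  case Nil
  then show ?case by (simp add: p gifs_cylinder_Nil)
next
  case (Cons e s)
  let ?G = "state_graph X"
  interpret fin_digraph ?G
    using X by (simp add: ordered_gifs_def)
  obtain l where l: "k = Suc l" and e: "e \<in> out_arcs ?G i" and s: "s \<in> gifs_walks X (head ?G e) l"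
    using Cons.prems(2) by (auto simp: Cons_in_gifs_walks_iff[OF X])
  have "(e, h) \<notin> Q" if h: "h \<in> arcs ?G" for h
  proof
    assume eh: "(e, h) \<in> Q"
    obtain t where "t \<in> gifs_walks X (head ?G h) l"
      using gifs_walks_nonempty[OF X, of "head ?G h" l] h by auto
    then have "h # t \<in> gifs_walks X i k"
      using h e Q[OF eh] by (auto simp: Cons_in_gifs_walks_iff[OF X] l)
    then show False using Cons.prems(3) eh by fastforce
  qed
  then have "edge_map X e (p (head ?G e)) = p i"
    using edge[of e] e by auto
  moreover have "p (head ?G e) \<in> gifs_cylinder X (head ?G e) s"
  proof (rule Cons.IH[OF _ s])
    show "head ?G e \<in> verts ?G" using e by simp
    fix \<xi> assume "\<xi> \<in> gifs_walks X (head ?G e) l"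
    then have "e # \<xi> \<in> gifs_walks X i k"
      using e by (auto simp: Cons_in_gifs_walks_iff[OF X] l)
    then show "(s, \<xi>) \<notin> lexord Q" using Cons.prems(3) by fastforce
  qed
  ultimately show ?case by (force simp: gifs_cylinder_Cons)
qed

text \<open>
  A common first edge can be cancelled, leaving adjacent walks. If the first edges \<open>e\<close> and \<open>f\<close> differ,
  no edge lies between them, nothing exceeds the rest of the smaller walk, and nothing precedes the
  rest of the larger one; so the junction of \<open>e\<close> and \<open>f\<close> is a common point of the cylinders.
\<close>

lemma adjacent_walks_meet:
  fixes X :: "('s, 'e, 'a::heine_borel) ordered_gifs_data"
  assumes X: "ordered_gifs X" and ch: "chained_endpoints X a b"
    and "i \<in> verts (state_graph X)" and "adjacent_walks X i k \<gamma> \<omega>"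
  shows "gifs_cylinder X i \<gamma> \<inter> gifs_cylinder X i \<omega> \<noteq> {}"
  using assms(3,4)
proof (induction k arbitrary: i \<gamma> \<omega>)
  case 0
  then show ?case by (auto simp: adjacent_walks_def gifs_walks_0 gifs_walk_less_eq_lexord)
next
  case (Suc k)
  let ?G = "state_graph X"
  interpret fin_digraph ?G
    using X by (simp add: ordered_gifs_def)
  note walks = Cons_in_gifs_walks_iff[OF X]
  note adj = Suc.prems(2)[unfolded adjacent_walks_def gifs_walk_less_eq_lexord]
  have "length \<gamma> = Suc k" "length \<omega> = Suc k"
    using adj by (auto simp: gifs_walks_def)
  then obtain e s f t where \<gamma>: "\<gamma> = e # s" and \<omega>: "\<omega> = f # t"
    by (metis length_Suc_conv)
  have e: "e \<in> out_arcs ?G i" and s: "s \<in> gifs_walks X (head ?G e) k"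
    and f: "f \<in> out_arcs ?G i" and t: "t \<in> gifs_walks X (head ?G f) k"
    using adj by (auto simp: \<gamma> \<omega> walks)
  have hv: "head ?G e \<in> verts ?G" "head ?G f \<in> verts ?G" using e f by auto
  have gap: "(e # s, h # \<xi>) \<notin> lexord (edge_less X) \<or> (h # \<xi>, f # t) \<notin> lexord (edge_less X)"
    if "h \<in> out_arcs ?G i" "\<xi> \<in> gifs_walks X (head ?G h) k" for h \<xi>
    using adj that unfolding \<gamma> \<omega> by (meson walks)
  show ?case
  proof (cases "e = f")
    case True
    have "adjacent_walks X (head ?G e) k s t"
      using adj s t gap[of e] e edge_less_irrefl[of e X]
      by (auto simp: adjacent_walks_def gifs_walk_less_eq_lexord \<gamma> \<omega> True)
    from Suc.IH[OF hv(1) this] show ?thesis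
      by (auto simp: \<gamma> \<omega> True gifs_cylinder_Cons)
  next
    case False
    then have ef: "(e, f) \<in> edge_less X"
      using adj by (auto simp: \<gamma> \<omega>)
    have "\<not> ((e, h) \<in> edge_less X \<and> (h, f) \<in> edge_less X)" if h: "h \<in> arcs ?G" for h
    proof
      assume eh: "(e, h) \<in> edge_less X \<and> (h, f) \<in> edge_less X"
      obtain \<xi> where "\<xi> \<in> gifs_walks X (head ?G h) k"
        using gifs_walks_nonempty[OF X, of "head ?G h" k] h by auto
      then show False
        using gap[of h \<xi>] h eh edge_less_tail[of e h X] e by auto
    qed
    then have meet: "edge_map X e (b (head ?G e)) = edge_map X f (a (head ?G f))"
      using ch ef e f by (auto simp: chained_endpoints_def Let_def)
    have "b (head ?G e) \<in> gifs_cylinder X (head ?G e) s"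
    proof (rule unbeaten_walk_contains_endpoint[OF X, where Q = "edge_less X", OF _ _ _ hv(1) s])
      fix \<xi> assume "\<xi> \<in> gifs_walks X (head ?G e) k"
      then show "(s, \<xi>) \<notin> lexord (edge_less X)"
        using gap[of e \<xi>] e ef by auto
    qed (use edge_less_tail endpoints_in_invariant_sets[OF X ch] ch in
        \<open>auto simp: chained_endpoints_def Let_def\<close>)
    moreover have "a (head ?G f) \<in> gifs_cylinder X (head ?G f) t"
    proof (rule unbeaten_walk_contains_endpoint[OF X, where Q = "(edge_less X)\<inverse>", OF _ _ _ hv(2) t])
      fix \<xi> assume \<xi>: "\<xi> \<in> gifs_walks X (head ?G f) k"
      then have "(\<xi>, t) \<notin> lexord (edge_less X)"
        using gap[of f \<xi>] f ef by auto
      moreover have "length t = length \<xi>"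
        using \<xi> t by (simp add: gifs_walks_def)
      ultimately show "(t, \<xi>) \<notin> lexord ((edge_less X)\<inverse>)"
        by (simp add: lexord_converse_eq_length)
    qed (use edge_less_tail[symmetric] endpoints_in_invariant_sets[OF X ch] ch in
        \<open>auto simp: chained_endpoints_def Let_def\<close>)
    ultimately show ?thesis
      unfolding \<gamma> \<omega> gifs_cylinder_Cons using meet imageI[of _ _ "edge_map X e"]
        imageI[of _ _ "edge_map X f"] by fastforce
  qed
qed

lemma chained_endpoints_imp_linear_gifs:
  fixes X :: "('s, 'e, 'a::heine_borel) ordered_gifs_data"
  assumes "ordered_gifs X" "chained_endpoints X a b"
  shows "linear_gifs X"
  unfolding linear_gifs_def by (intro conjI ballI allI impI assms(1) adjacent_walks_meet[OF assms])

section \<open>The induced GIFS\<close>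

lemma cas_consecutive:
  assumes "pre_digraph.cas G x p y" "Suc n < length p"
  shows "head G (p ! n) = tail G (p ! Suc n)"
  using assms
proof (induction p arbitrary: x n)
  case (Cons e p)
  then show ?case
    by (cases n; cases p) (auto simp: pre_digraph.cas.simps)
qed simp

lemma cas_first_last:
  assumes "pre_digraph.cas G x p y" "p \<noteq> []"
  shows "tail G (p ! 0) = x" "head G (p ! (length p - 1)) = y"
  using assms
proof (induction p arbitrary: x)
  case (Cons e p)
  {
    case 1
    then show ?case by (auto simp: pre_digraph.cas.simps)
  next
    case 2
    then show ?case using Cons.IH(2)[of "head G e"]
      by (cases p) (auto simp: pre_digraph.cas.simps)
  }
qed simp_all

lemma substitution_properties:
  assumes "edge_to_trail_substitution N S \<Lambda> P" "u \<in> arcs \<Lambda>"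
  shows "P u \<noteq> []"
    and "n < length (P u) \<Longrightarrow> fst (P u ! n) \<in> arcs \<Lambda> \<and> snd (P u ! n) \<in> {1..N}"
    and "S (snd (P u ! 0)) (tail \<Lambda> (fst (P u ! 0))) = tail \<Lambda> u"
    and "S (snd (P u ! (length (P u) - 1))) (head \<Lambda> (fst (P u ! (length (P u) - 1)))) = head \<Lambda> u"
    and "Suc n < length (P u) \<Longrightarrow>
      S (snd (P u ! n)) (head \<Lambda> (fst (P u ! n))) = S (snd (P u ! Suc n)) (tail \<Lambda> (fst (P u ! Suc n)))"
proof -
  let ?G = "refined_graph N S \<Lambda>"
  have G: "arcs ?G = arcs \<Lambda> \<times> {1..N}" "tail ?G p = S (snd p) (tail \<Lambda> (fst p))"
    "head ?G p = S (snd p) (head \<Lambda> (fst p))" for p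
    by (simp_all add: refined_graph_def case_prod_unfold)
  show ne: "P u \<noteq> []"
    using assms by (simp add: edge_to_trail_substitution_def)
  have "pre_digraph.trail ?G (tail \<Lambda> u) (P u) (head \<Lambda> u)"
    using assms by (simp add: edge_to_trail_substitution_def)
  then have cas: "pre_digraph.cas ?G (tail \<Lambda> u) (P u) (head \<Lambda> u)" and "set (P u) \<subseteq> arcs ?G"
    by (auto simp: pre_digraph.trail_def pre_digraph.awalk_def)
  then show "fst (P u ! n) \<in> arcs \<Lambda> \<and> snd (P u ! n) \<in> {1..N}" if "n < length (P u)"
    using nth_mem[OF that] unfolding G by (metis mem_Times_iff subsetD)
  show "S (snd (P u ! 0)) (tail \<Lambda> (fst (P u ! 0))) = tail \<Lambda> u"
    and "S (snd (P u ! (length (P u) - 1))) (head \<Lambda> (fst (P u ! (length (P u) - 1)))) = head \<Lambda> u"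
    using cas_first_last[OF cas ne] by (simp_all only: G)
  show "S (snd (P u ! n)) (head \<Lambda> (fst (P u ! n))) = S (snd (P u ! Suc n)) (tail \<Lambda> (fst (P u ! Suc n)))"
    if "Suc n < length (P u)"
    using cas_consecutive[OF cas that] by (simp only: G)
qed

lemma ordered_gifs_induced:
  assumes S: "ifs N S" and fin: "finite (arcs \<Lambda>)" and P: "edge_to_trail_substitution N S \<Lambda> P"
  shows "ordered_gifs (induced_gifs S \<Lambda> P)"
proof -
  let ?X = "induced_gifs S \<Lambda> P"
  let ?G = "state_graph ?X"
  note props = substitution_properties[OF P]
  have verts: "verts ?G = arcs \<Lambda>"
    by (simp add: induced_gifs_def)
  have "arcs ?G = (SIGMA u:arcs \<Lambda>. {..<length (P u)})"
    by (auto simp: induced_gifs_def)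
  then have "finite (arcs ?G)" using fin by simp
  then have "fin_digraph ?G"
    using fin props(2) by unfold_locales (auto simp: induced_gifs_def)
  moreover have "(u, 0) \<in> out_arcs ?G u" if "u \<in> arcs \<Lambda>" for u
    using props(1)[OF that] that by (simp add: induced_gifs_def)
  moreover have "contractive_similitude (edge_map ?X e)" if "e \<in> arcs ?G" for e
    using S props(2) that by (auto simp: induced_gifs_def ifs_def)
  moreover have "linear_order_on (out_arcs ?G u) (edge_ord ?X u)" if "u \<in> arcs \<Lambda>" for u
    using that
    by (auto simp: induced_gifs_def order_on_defs refl_on_def total_on_def trans_def antisym_def
        out_arcs_def)
  ultimately show ?thesis
    unfolding ordered_gifs_def verts by blast
qed

lemma chained_endpoints_induced:
  assumes P: "edge_to_trail_substitution N S \<Lambda> P"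
  shows "chained_endpoints (induced_gifs S \<Lambda> P) (tail \<Lambda>) (head \<Lambda>)"
proof -
  let ?X = "induced_gifs S \<Lambda> P"
  let ?G = "state_graph ?X"
  note props = substitution_properties[OF P]
  have less: "((u, m), (w, n)) \<in> edge_less ?X \<longleftrightarrow> u = w \<and> m < n \<and> n < length (P u)" for u w m n
    by (auto simp: edge_less_def induced_gifs_def)
  have arcs: "(u, n) \<in> arcs ?G \<longleftrightarrow> u \<in> arcs \<Lambda> \<and> n < length (P u)" for u n
    by (simp add: induced_gifs_def)
  have X: "edge_map ?X (u, n) x = S (snd (P u ! n)) x" "tail ?G (u, n) = u"
      "head ?G (u, n) = fst (P u ! n)" for u n x
    by (simp_all add: induced_gifs_def)
  have "edge_map ?X e (tail \<Lambda> (head ?G e)) = tail \<Lambda> (tail ?G e)"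
    if e: "e \<in> arcs ?G" and first: "\<forall>h\<in>arcs ?G. (h, e) \<notin> edge_less ?X" for e
  proof -
    obtain u n where un: "e = (u, n)" by fastforce
    have "(u, 0) \<in> arcs ?G" using e unfolding un arcs by auto
    then have "((u, 0), (u, n)) \<notin> edge_less ?X" using first un by blast
    then have "n = 0" using e by (simp add: un less arcs)
    then show ?thesis using props(3) e by (simp add: un X arcs)
  qed
  moreover have "edge_map ?X e (head \<Lambda> (head ?G e)) = head \<Lambda> (tail ?G e)"
    if e: "e \<in> arcs ?G" and last: "\<forall>h\<in>arcs ?G. (e, h) \<notin> edge_less ?X" for e
  proof -
    obtain u n where un: "e = (u, n)" by fastforce
    have "(u, length (P u) - 1) \<in> arcs ?G" using e unfolding un arcs by auto
    then have "((u, n), (u, length (P u) - 1)) \<notin> edge_less ?X" using last un by blast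
    then have "n = length (P u) - 1" using e by (auto simp: un less arcs)
    then show ?thesis using props(4) e by (simp add: un X arcs)
  qed
  moreover have "edge_map ?X e (head \<Lambda> (head ?G e)) = edge_map ?X f (tail \<Lambda> (head ?G f))"
    if e: "e \<in> arcs ?G" and ef: "(e, f) \<in> edge_less ?X"
      and gap: "\<not> (\<exists>h\<in>arcs ?G. (e, h) \<in> edge_less ?X \<and> (h, f) \<in> edge_less ?X)" for e f
  proof -
    obtain u m w n where eq: "e = (u, m)" "f = (w, n)" by fastforce
    have mn: "w = u" "m < n" "n < length (P u)" using ef by (auto simp: eq less)
    have "\<not> Suc m < n"
    proof
      assume "Suc m < n"
      then have "(u, Suc m) \<in> arcs ?G" "(e, (u, Suc m)) \<in> edge_less ?X"
        "((u, Suc m), f) \<in> edge_less ?X"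
        using e mn by (auto simp: eq arcs less)
      then show False using gap by blast
    qed
    then have "n = Suc m" using mn by simp
    then show ?thesis using props(5)[of u m] e mn by (simp add: eq X arcs)
  qed
  ultimately show ?thesis
    unfolding chained_endpoints_def Let_def by blast
qed

theorem theorem7p1:
  fixes N :: nat
    and S :: "nat \<Rightarrow> real ^ 'd \<Rightarrow> real ^ 'd"
    and A :: "(real ^ 'd) set"
    and \<Lambda> :: "(real ^ 'd, (real ^ 'd) \<times> (real ^ 'd)) pre_digraph"
    and P :: "(real ^ 'd) \<times> (real ^ 'd) \<Rightarrow> (((real ^ 'd) \<times> (real ^ 'd)) \<times> nat) list"
  assumes "ifs N S"
    and "open_set_condition N S"
    and "skeleton N S A"
    and "initial_graph A \<Lambda>"
    and "edge_to_trail_substitution N S \<Lambda> P"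
  shows "linear_gifs (induced_gifs S \<Lambda> P)"
proof -
  have "finite A" using assms(3) by (simp add: skeleton_def)
  moreover have "arcs \<Lambda> \<subseteq> A \<times> A"
    using assms(4) by (auto simp: initial_graph_def spanning_def subgraph_def complete_graph_on_def)
  ultimately have "finite (arcs \<Lambda>)" by (meson finite_SigmaI finite_subset)
  then have "ordered_gifs (induced_gifs S \<Lambda> P)"
    using ordered_gifs_induced assms(1,5) by blast
  then show ?thesis
    using chained_endpoints_induced[OF assms(5)] by (rule chained_endpoints_imp_linear_gifs)
qed

end
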